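(* Let $d\ge 3$. There exists a constant $C>0$, possibly depending on $d$ but not on $q$, such that for every $q\in(0,1)$ the spectral gap of the generator $\mathcal L$ of the Fredrickson-Andersen one spin facilitated model on $\mathbb Z^d$ with parameter $q$ satisfies $$\operatorname{gap}(\mathcal L)\le C\,q^{2}.$$
   Context: Fredrickson-Andersen one spin facilitated (FA1f) model on $\mathbb Z^d$ with parameter $q\in(0,1)$: the configuration space is $\Omega=\{0,1\}^{\mathbb Z^d}$; a site $x$ is empty for $\eta$ if $\eta(x)=0$ and occupied if $\eta(x)=1$. The measure $\mu$ on $\Omega$ is the product of Bernoulli measures with $\mu(\eta(x)=1)=1-q$, $\mu(\eta(x)=0)=q$. For $\eta\in\Omega$ and $x\in\mathbb Z^d$, $\eta^x$ denotes the configuration equal to $\eta$ off $x$ and different from $\eta$ at $x$. The constraint is $c_x(\eta)=1$ if there is $y$ with $\|y-x\|_1=1$ and $\eta(y)=0$, and $c_x(\eta)=0$ otherwise. In the dynamics, each site $x$ with $c_x(\eta)=1$ is resampled from its equilibrium Bernoulli law at rate $1$, and sites with $c_x(\eta)=0$ cannot change; the generator on local functions (functions depending on finitely many sites) is $\mathcal L f(\eta)=\sum_x c_x(\eta)\,(\mu_x(f)(\eta)-f(\eta))$, where $\mu_x(f)$ is the average of $f$ over the occupation of $x$ only. It is reversible with respect to $\mu$, with Dirichlet form $$\mathcal D(f)=\sum_{x\in\mathbb Z^d}\mu\big(c_x\operatorname{Var}_x(f)\big)=q(1-q)\sum_{x\in\mathbb Z^d}\mu\big(c_x(\eta)(f(\eta)-f(\eta^x))^2\big),$$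 where $\operatorname{Var}_x$ is the variance with respect to the occupation of $x$ only. The spectral gap is $\operatorname{gap}(\mathcal L)=\inf \mathcal D(f)/\operatorname{Var}(f)$, the infimum being over local functions $f:\Omega\to\mathbb R$ with $\operatorname{Var}(f)\neq0$, where $\operatorname{Var}$ is the variance with respect to $\mu$. *)

theory Defs
  imports "HOL-Probability.Probability"
begin

text \<open>
  Sites are the points of \<open>int ^ 'd\<close>, so the dimension is \<open>CARD('d)\<close>. In a configuration,
  \<open>True\<close> encodes an occupied site (value 1) and \<open>False\<close> an empty one (value 0).
\<close>

type_synonym 'd config = "(int ^ 'd) \<Rightarrow> bool"

definition site_law :: "real \<Rightarrow> bool pmf" where
  "site_law q = bernoulli_pmf (1 - q)"

definition equilibrium :: "real \<Rightarrow> 'd::finite config measure" where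
  "equilibrium q = (\<Pi>\<^sub>M x\<in>UNIV. measure_pmf (site_law q))"

definition l1_norm :: "int ^ 'd::finite \<Rightarrow> int" where
  "l1_norm v = (\<Sum>i\<in>UNIV. \<bar>v $ i\<bar>)"

definition FA1f_constraint :: "int ^ 'd::finite \<Rightarrow> 'd config \<Rightarrow> real" where
  "FA1f_constraint x \<eta> = (if \<exists>y. l1_norm (y - x) = 1 \<and> \<not> \<eta> y then 1 else 0)"

definition local_function :: "('d::finite config \<Rightarrow> real) \<Rightarrow> bool" where
  "local_function f \<longleftrightarrow>
     (\<exists>S. finite S \<and> (\<forall>\<eta> \<omega>. (\<forall>x\<in>S. \<eta> x = \<omega> x) \<longrightarrow> f \<eta> = f \<omega>))"

definition site_average ::
    "real \<Rightarrow> int ^ 'd::finite \<Rightarrow> ('d config \<Rightarrow> real) \<Rightarrow> 'd config \<Rightarrow> real" where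
  "site_average q x f \<eta> = measure_pmf.expectation (site_law q) (\<lambda>b. f (\<eta>(x := b)))"

definition site_variance ::
    "real \<Rightarrow> int ^ 'd::finite \<Rightarrow> ('d config \<Rightarrow> real) \<Rightarrow> 'd config \<Rightarrow> real" where
  "site_variance q x f \<eta> = measure_pmf.variance (site_law q) (\<lambda>b. f (\<eta>(x := b)))"

text \<open>
  On a local function the two sums over sites below have only finitely many nonzero terms, since
  \<open>site_average q x f = f\<close> and \<open>site_variance q x f = 0\<close> at every site \<open>x\<close> on which \<open>f\<close> does not
  depend.
\<close>

definition FA1f_generator ::
    "real \<Rightarrow> ('d::finite config \<Rightarrow> real) \<Rightarrow> 'd config \<Rightarrow> real" where
  "FA1f_generator q f \<eta> =
     (\<Sum>\<^sub>\<infinity>x\<in>UNIV. FA1f_constraint x \<eta> * (site_average q x f \<eta> - f \<eta>))"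

definition FA1f_dirichlet :: "real \<Rightarrow> ('d::finite config \<Rightarrow> real) \<Rightarrow> real" where
  "FA1f_dirichlet q f =
     (\<Sum>\<^sub>\<infinity>x\<in>UNIV. \<integral>\<eta>. FA1f_constraint x \<eta> * site_variance q x f \<eta> \<partial>equilibrium q)"

definition equilibrium_variance :: "real \<Rightarrow> ('d::finite config \<Rightarrow> real) \<Rightarrow> real" where
  "equilibrium_variance q f = prob_space.variance (equilibrium q) f"

definition FA1f_gap :: "'d::finite itself \<Rightarrow> real \<Rightarrow> real" where
  "FA1f_gap _ q =
     Inf {FA1f_dirichlet q f / equilibrium_variance q f | f :: 'd config \<Rightarrow> real.
            local_function f \<and> equilibrium_variance q f \<noteq> 0}"

text \<open>
  For local \<open>f\<close>, \<open>FA1f_dirichlet_eq_generator\<close> below identifies \<open>FA1f_dirichlet\<close> as the Dirichlet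
  form of \<open>FA1f_generator\<close>, and \<open>site_variance_eq_flip\<close> rewrites the local variance with the flipped
  configuration \<open>\<eta>(x := \<not> \<eta> x)\<close>.
\<close>

lemma prob_space_equilibrium: "prob_space (equilibrium q)"
  unfolding equilibrium_def by (intro prob_space_PiM prob_space_measure_pmf)

lemma space_equilibrium [simp]: "space (equilibrium q) = UNIV"
  by (simp add: equilibrium_def space_PiM)

lemma local_functionI:
  assumes "finite S" "\<And>\<eta> \<omega>. (\<And>x. x \<in> S \<Longrightarrow> \<eta> x = \<omega> x) \<Longrightarrow> f \<eta> = f \<omega>"
  shows "local_function f"
  unfolding local_function_def
proof (intro exI[of _ S] conjI allI impI)
  show "finite S" by (rule assms(1))
  show "f \<eta> = f \<omega>" if "\<forall>x\<in>S. \<eta> x = \<omega> x" for \<eta> \<omega>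
    by (rule assms(2)) (rule bspec[OF that])
qed

lemma local_function_integrable:
  fixes f :: "'d::finite config \<Rightarrow> real"
  assumes "local_function f"
  shows "integrable (equilibrium q) f"
proof -
  interpret prob_space "equilibrium q" by (rule prob_space_equilibrium)
  from assms
  obtain S where S0: "finite S"
      "\<forall>\<eta> \<omega>. (\<forall>x\<in>S. \<eta> x = \<omega> x) \<longrightarrow> f \<eta> = f \<omega>"
    unfolding local_function_def by (elim exE conjE) (rule that)
  note S = S0(1) S0(2)[rule_format]
  let ?E = "\<lambda>T. {\<eta> \<in> space (equilibrium q). \<forall>x\<in>S. \<eta> x = (x \<in> T)}"
  have eq: "f = (\<lambda>\<eta>. \<Sum>T\<in>Pow S. f (\<lambda>x. x \<in> T) * indicator (?E T) \<eta>)"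
  proof
    fix \<eta>
    let ?T = "{x \<in> S. \<eta> x}"
    have "(\<Sum>T\<in>Pow S. f (\<lambda>x. x \<in> T) * indicator (?E T) \<eta>)
        = (\<Sum>T\<in>Pow S. if T = ?T then f (\<lambda>x. x \<in> T) else 0)"
      by (intro sum.cong) (auto simp: indicator_def)
    also have "\<dots> = f (\<lambda>x. x \<in> ?T)" using S(1) by simp
    also have "\<dots> = f \<eta>" by (rule S(2)) auto
    finally show "f \<eta> = (\<Sum>T\<in>Pow S. f (\<lambda>x. x \<in> T) * indicator (?E T) \<eta>)" by simp
  qed
  have comp: "(\<lambda>\<eta>. \<eta> x) \<in> equilibrium q \<rightarrow>\<^sub>M count_space UNIV" for x :: "int ^ 'd"
    unfolding equilibrium_def
    using measurable_component_singleton[of x UNIV "\<lambda>_. measure_pmf (site_law q)"]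
    by simp
  have atom: "{\<eta> \<in> space (equilibrium q). \<eta> x = b} \<in> sets (equilibrium q)" for x :: "int ^ 'd" and b
    by (rule measurable_sets_Collect[OF comp]) simp
  have "?E T \<in> sets (equilibrium q)" for T
    by (rule sets.sets_Collect_finite_All[OF atom S(1)])
  hence "integrable (equilibrium q) (\<lambda>\<eta>. \<Sum>T\<in>Pow S. f (\<lambda>x. x \<in> T) * indicator (?E T) \<eta>)"
    by (intro Bochner_Integration.integrable_sum integrable_mult_right integrable_real_indicator)
       (auto simp: emeasure_eq_measure)
  thus ?thesis unfolding eq[symmetric] .
qed

lemma integral_site_average:
  fixes f :: "'d::finite config \<Rightarrow> real"
  assumes "local_function f"
  shows "(\<integral>\<eta>. f \<eta> \<partial>equilibrium q) = (\<integral>\<eta>. site_average q x f \<eta> \<partial>equilibrium q)"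
proof -
  let ?M = "measure_pmf (site_law q)" and ?E = "equilibrium q :: 'd config measure"
  interpret E: prob_space ?E by (rule prob_space_equilibrium)
  interpret pair_prob_space ?M ?E ..
  have d: "distr (?M \<Otimes>\<^sub>M ?E) ?E (\<lambda>(b, \<eta>). \<eta>(x := b)) = ?E"
    using distr_pair_PiM_eq_PiM[of UNIV "\<lambda>_. ?M" x, OF prob_space_measure_pmf prob_space_measure_pmf]
    unfolding equilibrium_def insert_UNIV .
  have m: "(\<lambda>(b, \<eta>). \<eta>(x := b)) \<in> ?M \<Otimes>\<^sub>M ?E \<rightarrow>\<^sub>M ?E"
    unfolding equilibrium_def case_prod_beta'
    by (rule measurable_fun_upd[where J = UNIV and I = UNIV])
      (simp, rule measurable_snd, rule measurable_fst)
  have i: "integrable ?E f" by (rule local_function_integrable) fact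
  hence b: "f \<in> borel_measurable ?E" by simp
  have "(\<integral>\<eta>. f \<eta> \<partial>?E) = (\<integral>p. f ((snd p)(x := fst p)) \<partial>(?M \<Otimes>\<^sub>M ?E))"
    using integral_distr[OF m b] unfolding d case_prod_beta .
  also have "\<dots> = (\<integral>\<eta>. \<integral>b. f (\<eta>(x := b)) \<partial>?M \<partial>?E)"
  proof -
    have "integrable (distr (?M \<Otimes>\<^sub>M ?E) ?E (\<lambda>(b, \<eta>). \<eta>(x := b))) f"
      using i unfolding d .
    from integrable_distr[OF m this]
    have "integrable (?M \<Otimes>\<^sub>M ?E) (\<lambda>(b, \<eta>). f (\<eta>(x := b)))"
      unfolding case_prod_beta' .
    from integral_snd[OF this] show ?thesis
      unfolding case_prod_beta' by (rule sym)
  qed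
  finally show ?thesis unfolding site_average_def[abs_def] .
qed

lemma site_average_local:
  fixes f :: "'d::finite config \<Rightarrow> real"
  assumes "local_function f"
  shows "local_function (site_average q x f)"
proof -
  from assms
  obtain S where S0: "finite S"
      "\<forall>\<eta> \<omega>. (\<forall>x\<in>S. \<eta> x = \<omega> x) \<longrightarrow> f \<eta> = f \<omega>"
    unfolding local_function_def by (elim exE conjE) (rule that)
  note S = S0(1) S0(2)[rule_format]
  show ?thesis
    unfolding site_average_def
    by (intro local_functionI[OF S(1)] arg_cong2[where f = "integral\<^sup>L"] ext S(2) refl) auto
qed

lemma finite_l1_sphere: "finite {y :: int ^ 'd::finite. l1_norm (y - x) = 1}"
proof (rule finite_subset)
  show "{y :: int ^ 'd. l1_norm (y - x) = 1} \<subseteq>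
          vec_lambda ` (PiE UNIV (\<lambda>i. {x $ i - 1..x $ i + 1}))"
  proof
    fix y :: "int ^ 'd" assume "y \<in> {y. l1_norm (y - x) = 1}"
    hence y: "(\<Sum>i\<in>UNIV. \<bar>y $ i - x $ i\<bar>) = 1" by (simp add: l1_norm_def)
    have "y $ i \<in> {x $ i - 1..x $ i + 1}" for i
    proof -
      have "\<bar>y $ i - x $ i\<bar> \<le> (\<Sum>i\<in>UNIV. \<bar>y $ i - x $ i\<bar>)"
        by (rule member_le_sum) simp_all
      hence "\<bar>y $ i - x $ i\<bar> \<le> 1" unfolding y .
      thus ?thesis by (simp add: abs_le_iff)
    qed
    hence "vec_nth y \<in> PiE UNIV (\<lambda>i. {x $ i - 1..x $ i + 1})"
      by (intro PiE_I) simp_all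
    thus "y \<in> vec_lambda ` (PiE UNIV (\<lambda>i. {x $ i - 1..x $ i + 1}))"
      by (intro image_eqI[where x = "vec_nth y"]) (simp_all only: vec_nth_inverse)
  qed
qed (intro finite_imageI finite_PiE; simp)

lemma FA1f_constraint_local: "local_function (FA1f_constraint x)"
  by (rule local_functionI[OF finite_l1_sphere[of x]]) (auto simp: FA1f_constraint_def)

lemma local_function_mult:
  assumes "local_function f" "local_function g"
  shows "local_function (\<lambda>\<eta>. f \<eta> * g \<eta>)"
proof -
  from assms(1)
  obtain S where S0: "finite S"
      "\<forall>\<eta> \<omega>. (\<forall>x\<in>S. \<eta> x = \<omega> x) \<longrightarrow> f \<eta> = f \<omega>"
    unfolding local_function_def by (elim exE conjE) (rule that)
  note S = S0(1) S0(2)[rule_format]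
  from assms(2)
  obtain T where T0: "finite T"
      "\<forall>\<eta> \<omega>. (\<forall>x\<in>T. \<eta> x = \<omega> x) \<longrightarrow> g \<eta> = g \<omega>"
    unfolding local_function_def by (elim exE conjE) (rule that)
  note T = T0(1) T0(2)[rule_format]
  show ?thesis
  proof (rule local_functionI)
    show "finite (S \<union> T)" using S T by simp
    show "f \<eta> * g \<eta> = f \<omega> * g \<omega>" if "\<And>x. x \<in> S \<union> T \<Longrightarrow> \<eta> x = \<omega> x" for \<eta> \<omega>
      using S(2)[of \<eta> \<omega>] T(2)[of \<eta> \<omega>] that by auto
  qed
qed

lemma local_function_diff:
  assumes "local_function f" "local_function g"
  shows "local_function (\<lambda>\<eta>. f \<eta> - g \<eta>)"
proof -
  from assms(1)
  obtain S where S0: "finite S"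
      "\<forall>\<eta> \<omega>. (\<forall>x\<in>S. \<eta> x = \<omega> x) \<longrightarrow> f \<eta> = f \<omega>"
    unfolding local_function_def by (elim exE conjE) (rule that)
  note S = S0(1) S0(2)[rule_format]
  from assms(2)
  obtain T where T0: "finite T"
      "\<forall>\<eta> \<omega>. (\<forall>x\<in>T. \<eta> x = \<omega> x) \<longrightarrow> g \<eta> = g \<omega>"
    unfolding local_function_def by (elim exE conjE) (rule that)
  note T = T0(1) T0(2)[rule_format]
  show ?thesis
  proof (rule local_functionI)
    show "finite (S \<union> T)" using S T by simp
    show "f \<eta> - g \<eta> = f \<omega> - g \<omega>" if "\<And>x. x \<in> S \<union> T \<Longrightarrow> \<eta> x = \<omega> x" for \<eta> \<omega>
      using S(2)[of \<eta> \<omega>] T(2)[of \<eta> \<omega>] that by auto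
  qed
qed

lemma FA1f_constraint_upd: "FA1f_constraint x (\<eta>(x := b)) = FA1f_constraint x \<eta>"
proof -
  have "(l1_norm (y - x) = 1 \<and> \<not> (\<eta>(x := b)) y) = (l1_norm (y - x) = 1 \<and> \<not> \<eta> y)" for y
    by (cases "y = x") (auto simp: l1_norm_def)
  thus ?thesis unfolding FA1f_constraint_def by presburger
qed

lemma integral_constraint_site_variance:
  fixes f :: "'d::finite config \<Rightarrow> real"
  assumes f: "local_function f"
  shows "(\<integral>\<eta>. FA1f_constraint x \<eta> * site_variance q x f \<eta> \<partial>equilibrium q) =
         (\<integral>\<eta>. f \<eta> * (FA1f_constraint x \<eta> * (f \<eta> - site_average q x f \<eta>)) \<partial>equilibrium q)"
    (is "?l = (\<integral>\<eta>. ?h \<eta> \<partial>_)")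
proof -
  have "local_function ?h"
    by (intro local_function_mult local_function_diff f FA1f_constraint_local site_average_local)
  hence "(\<integral>\<eta>. ?h \<eta> \<partial>equilibrium q) = (\<integral>\<eta>. site_average q x ?h \<eta> \<partial>equilibrium q)"
    by (rule integral_site_average)
  moreover have "site_average q x ?h \<eta> = FA1f_constraint x \<eta> * site_variance q x f \<eta>" for \<eta>
  proof -
    let ?X = "\<lambda>b. f (\<eta>(x := b))" and ?p = "site_law q"
    have int: "integrable (measure_pmf ?p) (g :: bool \<Rightarrow> real)" for g
      by (rule integrable_measure_pmf_finite) (rule finite_subset[of _ UNIV], auto)
    have "site_average q x ?h \<eta> = measure_pmf.expectation ?p
        (\<lambda>b. FA1f_constraint x \<eta> * ((?X b)\<^sup>2 - site_average q x f \<eta> * ?X b))"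
      by (simp add: site_average_def FA1f_constraint_upd algebra_simps power2_eq_square)
    also have "\<dots> = FA1f_constraint x \<eta> *
        (measure_pmf.expectation ?p (\<lambda>b. (?X b)\<^sup>2) - (site_average q x f \<eta>)\<^sup>2)"
      by (simp add: int site_average_def power2_eq_square)
    also have "\<dots> = FA1f_constraint x \<eta> * site_variance q x f \<eta>"
      unfolding site_variance_def site_average_def
      by (subst measure_pmf.variance_eq) (auto simp: int)
    finally show ?thesis .
  qed
  ultimately show ?thesis by (simp only:)
qed

lemma FA1f_dirichlet_eq_generator:
  fixes f :: "'d::finite config \<Rightarrow> real"
  assumes f: "local_function f"
  shows "FA1f_dirichlet q f = - (\<integral>\<eta>. f \<eta> * FA1f_generator q f \<eta> \<partial>equilibrium q)"
proof -
  from assms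
  obtain S where S0: "finite S"
      "\<forall>\<eta> \<omega>. (\<forall>x\<in>S. \<eta> x = \<omega> x) \<longrightarrow> f \<eta> = f \<omega>"
    unfolding local_function_def by (elim exE conjE) (rule that)
  note S = S0(1) S0(2)[rule_format]
  have upd: "f (\<eta>(x := b)) = f \<eta>" if "x \<notin> S" for x b \<eta>
    using that by (intro S(2)) auto
  have var0: "site_variance q x f \<eta> = 0" if "x \<notin> S" for x \<eta>
    by (simp add: site_variance_def upd[OF that])
  have avg0: "site_average q x f \<eta> = f \<eta>" if "x \<notin> S" for x \<eta>
    by (simp add: site_average_def upd[OF that])
  let ?g = "\<lambda>x \<eta>. f \<eta> * (FA1f_constraint x \<eta> * (f \<eta> - site_average q x f \<eta>))"
  have gen: "FA1f_generator q f \<eta> =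
      (\<Sum>x\<in>S. FA1f_constraint x \<eta> * (site_average q x f \<eta> - f \<eta>))" for \<eta>
    unfolding FA1f_generator_def infsum_finite[OF S(1), symmetric]
    by (intro infsum_cong_neutral) (auto simp: avg0)
  have "FA1f_dirichlet q f =
      (\<Sum>x\<in>S. \<integral>\<eta>. FA1f_constraint x \<eta> * site_variance q x f \<eta> \<partial>equilibrium q)"
    unfolding FA1f_dirichlet_def infsum_finite[OF S(1), symmetric]
    by (intro infsum_cong_neutral) (auto simp: var0)
  also have "\<dots> = (\<Sum>x\<in>S. \<integral>\<eta>. ?g x \<eta> \<partial>equilibrium q)"
    by (simp add: integral_constraint_site_variance f)
  also have "\<dots> = (\<integral>\<eta>. (\<Sum>x\<in>S. ?g x \<eta>) \<partial>equilibrium q)"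
    by (intro Bochner_Integration.integral_sum[symmetric] local_function_integrable
          local_function_mult local_function_diff f FA1f_constraint_local site_average_local)
  also have "(\<lambda>\<eta>. \<Sum>x\<in>S. ?g x \<eta>) = (\<lambda>\<eta>. - (f \<eta> * FA1f_generator q f \<eta>))"
    unfolding gen by (simp add: sum_distrib_left sum_negf[symmetric] algebra_simps)
  finally show ?thesis by simp
qed

lemma site_variance_eq_flip:
  assumes "0 \<le> q" "q \<le> 1"
  shows "site_variance q x f \<eta> = q * (1 - q) * (f \<eta> - f (\<eta>(x := \<not> \<eta> x)))\<^sup>2"
proof -
  have "site_variance q x f \<eta> = q * (1 - q) * (f (\<eta>(x := True)) - f (\<eta>(x := False)))\<^sup>2"
    using assms by (simp add: site_variance_def site_law_def power2_eq_square algebra_simps)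
  thus ?thesis
    by (cases "\<eta> x") (simp_all add: fun_upd_idem power2_commute)
qed

end

theory Submission
  imports Defs
begin

text \<open>
  When \<open>q\<close> is small the empty sites (vacancies) are rare. An isolated vacancy creates a vacancy
  next to it at rate of order \<open>q\<close>, and one of the two disappears soon afterwards. Such moves
  displace or enlarge a cluster of vacancies, but they do not change the number of clusters. To
  change that number, two vacancies must be present around a third site, which is rarer by a factor
  \<open>q\<close>. The number of clusters is therefore a slow observable, and it serves as the test function.

  The number of clusters is replaced by a function with the same property and simpler algebra: the
  Euler characteristic of the vacancies in a finite set \<open>A\<close>, that is, the number of vacancies in \<open>A\<close>
  minus the number of adjacent pairs of them. Emptying a site with \<open>k\<close> vacant neighbours in \<open>A\<close>
  changes it by \<open>1 - k\<close> (\<open>euler_char_flip\<close>), and a flip that changes nothing costs nothing.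

  Dirichlet form. The constraint excludes flips with no vacant neighbour at all, so an allowed
  flip that changes the function has two vacant neighbours in \<open>A\<close>, of probability \<open>O(q\<^sup>2)\<close>, or it
  has a vacant neighbour outside \<open>A\<close>, of probability \<open>O(q)\<close>
  (\<open>constraint_flip_le\<close>). Hence the form is at most
  \<open>q * (1 - q)\<close> times \<open>O(q\<^sup>2 * |A| + q * |boundary of A|)\<close>.

  Variance. The linear part of the function is the number of vacancies, with coefficients
  \<open>1 - O(q)\<close>, so the variance is at least of order \<open>q * (1 - q) * |A|\<close>, as that of a sum of
  independent variables (\<open>equilibrium_variance_euler_char_ge\<close>).

  The quotient is \<open>O(q\<^sup>2 + q * |boundary of A| / |A|)\<close>, and a box of side at least \<open>1 / q\<close> makes this
  \<open>O(q\<^sup>2)\<close>. When \<open>q\<close> is not small, a bound by a constant suffices, and \<open>A = {0}\<close> provides it. All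
  expectations reduce to resampling one site (\<open>integral_times_centred_vacancy\<close>).
\<close>

section \<open>Local functions and vacancies\<close>

lemma local_function_const: "local_function (\<lambda>\<eta>. c)"
  by (rule local_functionI[of "{}"]) auto

lemma local_function_add:
  assumes "local_function f" "local_function g"
  shows "local_function (\<lambda>\<eta>. f \<eta> + g \<eta>)"
  using local_function_diff[OF assms(1) local_function_diff[OF local_function_const[of 0] assms(2)]]
  by simp

lemma local_function_sum:
  assumes "\<And>i. i \<in> I \<Longrightarrow> local_function (f i)"
  shows "local_function (\<lambda>\<eta>. \<Sum>i\<in>I. f i \<eta>)"
  using assms
  by (induction I rule: infinite_finite_induct)
    (simp_all add: local_function_const local_function_add)

lemma local_function_power2: "local_function f \<Longrightarrow> local_function (\<lambda>\<eta>. (f \<eta>)\<^sup>2)"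
  unfolding power2_eq_square by (rule local_function_mult)

definition vacancy :: "int ^ 'd::finite \<Rightarrow> 'd config \<Rightarrow> real" where
  "vacancy x \<eta> = (if \<eta> x then 0 else 1)"

lemma vacancy_upd: "vacancy x (\<eta>(y := b)) = (if x = y then (if b then 0 else 1) else vacancy x \<eta>)"
  by (simp add: vacancy_def)

lemma vacancy_nonneg: "0 \<le> vacancy x \<eta>"
  by (simp add: vacancy_def)

lemma vacancy_idem: "vacancy x \<eta> * vacancy x \<eta> = vacancy x \<eta>"
  by (simp add: vacancy_def)

lemma local_function_vacancy: "local_function (vacancy x)"
  by (rule local_functionI[of "{x}"]) (auto simp: vacancy_def)

lemmas local_intros =
  local_function_const local_function_add local_function_diff local_function_mult
  local_function_sum local_function_power2 local_function_vacancy FA1f_constraint_local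

lemmas integral_simps =
  Bochner_Integration.integral_add Bochner_Integration.integral_diff
  Bochner_Integration.integral_sum

lemma measure_equilibrium_UNIV: "measure (equilibrium q :: 'd::finite config measure) UNIV = 1"
  using prob_space.prob_space[OF prob_space_equilibrium] by simp

text \<open>
  A discrete integration by parts: after averaging over the site \<open>x\<close> alone, only the difference of
  the two values of \<open>h\<close> is left. With \<open>h\<close> constant, a vacancy, or a test function, this identity
  yields the first moments, the pair moments and the covariances.
\<close>

lemma integral_times_centred_vacancy:
  fixes h :: "'d::finite config \<Rightarrow> real"
  assumes q: "q \<in> {0<..<1}" and h: "local_function h"
  shows "(\<integral>\<eta>. h \<eta> * (vacancy x \<eta> - q) \<partial>equilibrium q) =
    q * (1 - q) * (\<integral>\<eta>. h (\<eta>(x := False)) - h (\<eta>(x := True)) \<partial>equilibrium q)"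
proof -
  have "(\<integral>\<eta>. h \<eta> * (vacancy x \<eta> - q) \<partial>equilibrium q) =
      (\<integral>\<eta>. site_average q x (\<lambda>\<eta>. h \<eta> * (vacancy x \<eta> - q)) \<eta> \<partial>equilibrium q)"
    by (intro integral_site_average local_intros h)
  also have "\<dots> = (\<integral>\<eta>. q * (1 - q) * (h (\<eta>(x := False)) - h (\<eta>(x := True))) \<partial>equilibrium q)"
    using q by (simp add: site_average_def site_law_def vacancy_upd algebra_simps)
  finally show ?thesis by simp
qed

lemma integral_vacancy:
  assumes q: "q \<in> {0<..<1}"
  shows "(\<integral>\<eta>. vacancy (x :: int ^ 'd::finite) \<eta> \<partial>equilibrium q) = q"
proof -
  have "(\<integral>\<eta>. vacancy x \<eta> - q \<partial>equilibrium q) = 0"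
    using integral_times_centred_vacancy[OF q local_function_const[of 1], of x] by simp
  then show ?thesis
    by (simp add: integral_simps local_function_integrable local_intros measure_equilibrium_UNIV)
qed

lemma integral_vacancy_mult:
  assumes q: "q \<in> {0<..<1}" and "x \<noteq> y"
  shows "(\<integral>\<eta>. vacancy x \<eta> * vacancy y \<eta> \<partial>equilibrium q) = q\<^sup>2"
proof -
  have "(\<integral>\<eta>. vacancy x \<eta> * (vacancy y \<eta> - q) \<partial>equilibrium q) = 0"
    using integral_times_centred_vacancy[OF q local_function_vacancy, of x y] assms(2)
    by (simp add: vacancy_upd)
  moreover have "(\<lambda>\<eta>. vacancy x \<eta> * (vacancy y \<eta> - q)) =
      (\<lambda>\<eta>. vacancy x \<eta> * vacancy y \<eta> - q * vacancy x \<eta>)"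
    by (simp add: algebra_simps)
  ultimately show ?thesis
    by (simp add: integral_simps local_function_integrable local_intros integral_vacancy[OF q]
        power2_eq_square)
qed

section \<open>The Euler characteristic of the vacancies\<close>

definition neighbours :: "int ^ 'd::finite \<Rightarrow> (int ^ 'd) set" where
  "neighbours x = {y. l1_norm (y - x) = 1}"

lemma finite_neighbours: "finite (neighbours x)"
  unfolding neighbours_def by (rule finite_l1_sphere)

lemma not_in_own_neighbours: "x \<notin> neighbours x"
  by (simp add: neighbours_def l1_norm_def)

lemma neighbours_sym: "y \<in> neighbours x \<longleftrightarrow> x \<in> neighbours y"
  by (simp add: neighbours_def l1_norm_def abs_minus_commute)

lemma neighbours_eq_translate: "neighbours x = (+) x ` neighbours 0"
  by (force simp: neighbours_def image_iff intro: exI[of _ "_ - x"])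

lemma card_neighbours:
  "card (neighbours (x :: int ^ 'd::finite)) = card (neighbours (0 :: int ^ 'd))"
  by (simp add: neighbours_eq_translate[of x] card_image)

definition vacant_neighbours :: "(int ^ 'd::finite) set \<Rightarrow> int ^ 'd \<Rightarrow> 'd config \<Rightarrow> real" where
  "vacant_neighbours A x \<eta> = (\<Sum>y\<in>A \<inter> neighbours x. vacancy y \<eta>)"

text \<open>
  The sum over \<open>x\<close> of the vacant neighbours of \<open>x\<close> counts each adjacent pair of vacancies twice, hence
  the division by 2.
\<close>

definition euler_char :: "(int ^ 'd::finite) set \<Rightarrow> 'd config \<Rightarrow> real" where
  "euler_char A \<eta> = (\<Sum>x\<in>A. vacancy x \<eta>) - (\<Sum>x\<in>A. vacancy x \<eta> * vacant_neighbours A x \<eta>) / 2"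

lemma local_function_vacant_neighbours: "local_function (vacant_neighbours A x)"
  unfolding vacant_neighbours_def by (intro local_intros)

lemma local_function_euler_char: "local_function (euler_char A)"
  unfolding euler_char_def divide_inverse
  by (intro local_intros local_function_vacant_neighbours)

lemma vacant_neighbours_upd_self: "vacant_neighbours A x (\<eta>(x := b)) = vacant_neighbours A x \<eta>"
  unfolding vacant_neighbours_def
  by (rule sum.cong) (auto simp: vacancy_upd not_in_own_neighbours)

lemma euler_char_upd_outside:
  assumes "z \<notin> A"
  shows "euler_char A (\<eta>(z := b)) = euler_char A \<eta>"
proof -
  have v: "vacancy x (\<eta>(z := b)) = vacancy x \<eta>" if "x \<in> A" for x
    using that assms by (auto simp: vacancy_upd)
  have "vacant_neighbours A x (\<eta>(z := b)) = vacant_neighbours A x \<eta>" for x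
    unfolding vacant_neighbours_def by (rule sum.cong) (auto simp: v)
  then show ?thesis unfolding euler_char_def by (simp add: v)
qed

text \<open>
  Emptying \<open>z\<close> adds one vertex to the graph of vacancies, and one edge for each of its vacant
  neighbours. The change vanishes exactly when the new vacancy is attached to exactly one old vacancy.
\<close>

lemma euler_char_flip:
  assumes A: "finite A" and z: "z \<in> A"
  shows "euler_char A (\<eta>(z := False)) - euler_char A (\<eta>(z := True)) = 1 - vacant_neighbours A z \<eta>"
proof -
  define F T where FT: "F = \<eta>(z := False)" "T = \<eta>(z := True)"
  let ?\<delta> = "\<lambda>x. if x = z then 1 else 0 :: real"
  let ?n = "\<lambda>x. if z \<in> neighbours x then 1 else 0 :: real"
  have v: "vacancy x F = vacancy x T + ?\<delta> x" for x
    by (simp add: FT vacancy_upd)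
  have self: "vacant_neighbours A z F = vacant_neighbours A z \<eta>"
      "vacant_neighbours A z T = vacant_neighbours A z \<eta>"
    by (simp_all add: FT vacant_neighbours_upd_self)
  have vz: "vacancy z T = 0" by (simp add: FT vacancy_upd)
  have nb: "vacant_neighbours A x F = vacant_neighbours A x T + ?n x" for x
    using A z by (simp add: vacant_neighbours_def v sum.distrib)
  \<comment> \<open>The double sum is a symmetric bilinear form with zero diagonal, taken at \<open>T\<close> plus the unit
    vector at \<open>z\<close>: expanding it gives two equal cross terms and no square term.\<close>
  have "(\<Sum>x\<in>A. vacancy x F * vacant_neighbours A x F) =
      (\<Sum>x\<in>A. vacancy x T * vacant_neighbours A x T + vacancy x T * ?n x
        + (if x = z then vacant_neighbours A z \<eta> else 0))"
    by (intro sum.cong refl)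
      (auto simp: v nb algebra_simps self vz not_in_own_neighbours)
  also have "\<dots> = (\<Sum>x\<in>A. vacancy x T * vacant_neighbours A x T)
      + (\<Sum>x\<in>A. vacancy x T * ?n x) + vacant_neighbours A z \<eta>"
    using A z by (simp add: sum.distrib)
  also have "(\<Sum>x\<in>A. vacancy x T * ?n x) = vacant_neighbours A z T"
    using A unfolding vacant_neighbours_def sum.inter_restrict[OF A]
    by (intro sum.cong) (auto simp: neighbours_sym[of z])
  finally have "(\<Sum>x\<in>A. vacancy x F * vacant_neighbours A x F) =
      (\<Sum>x\<in>A. vacancy x T * vacant_neighbours A x T) + 2 * vacant_neighbours A z \<eta>"
    by (simp add: self)
  moreover have "(\<Sum>x\<in>A. vacancy x F) = (\<Sum>x\<in>A. vacancy x T) + 1"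
    using A z by (simp add: v sum.distrib)
  ultimately show ?thesis unfolding euler_char_def FT[symmetric] by (simp add: add_divide_distrib)
qed

section \<open>The Dirichlet form\<close>

lemma integral_equilibrium_mono:
  fixes f g :: "'d::finite config \<Rightarrow> real"
  assumes "local_function f" "local_function g" "\<And>\<eta>. f \<eta> \<le> g \<eta>"
  shows "(\<integral>\<eta>. f \<eta> \<partial>equilibrium q) \<le> (\<integral>\<eta>. g \<eta> \<partial>equilibrium q)"
  using assms by (intro integral_mono local_function_integrable)

lemma FA1f_dirichlet_nonneg:
  assumes "q \<in> {0<..<1}"
  shows "0 \<le> FA1f_dirichlet q f"
  unfolding FA1f_dirichlet_def using assms
  by (intro infsum_nonneg Bochner_Integration.integral_nonneg)
    (simp add: FA1f_constraint_def site_variance_eq_flip)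

lemma FA1f_dirichlet_euler_char:
  fixes A :: "(int ^ 'd::finite) set" and q :: real
  assumes q: "q \<in> {0<..<1}" and A: "finite A"
  shows "FA1f_dirichlet q (euler_char A) = q * (1 - q) *
    (\<Sum>x\<in>A. \<integral>\<eta>. FA1f_constraint x \<eta> * (1 - vacant_neighbours A x \<eta>)\<^sup>2 \<partial>equilibrium q)"
proof -
  have var0: "site_variance q x (euler_char A) \<eta> = 0" if "x \<notin> A" for x \<eta>
    using q that by (simp add: site_variance_eq_flip euler_char_upd_outside)
  have var: "site_variance q x (euler_char A) \<eta> = q * (1 - q) * (1 - vacant_neighbours A x \<eta>)\<^sup>2"
    if "x \<in> A" for x \<eta>
  proof -
    have "(euler_char A \<eta> - euler_char A (\<eta>(x := \<not> \<eta> x)))\<^sup>2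
        = (euler_char A (\<eta>(x := False)) - euler_char A (\<eta>(x := True)))\<^sup>2"
      by (cases "\<eta> x") (simp_all add: fun_upd_idem power2_commute)
    then show ?thesis
      using q by (simp add: site_variance_eq_flip euler_char_flip[OF A that])
  qed
  have "FA1f_dirichlet q (euler_char A) =
      (\<Sum>x\<in>A. \<integral>\<eta>. FA1f_constraint x \<eta> * site_variance q x (euler_char A) \<eta> \<partial>equilibrium q)"
    unfolding FA1f_dirichlet_def infsum_finite[OF A, symmetric]
    by (intro infsum_cong_neutral) (auto simp: var0)
  also have "\<dots> = (\<Sum>x\<in>A. q * (1 - q) *
      (\<integral>\<eta>. FA1f_constraint x \<eta> * (1 - vacant_neighbours A x \<eta>)\<^sup>2 \<partial>equilibrium q))"
    by (intro sum.cong refl) (simp add: var mult.left_commute[of _ "q * (1 - q)"])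
  finally show ?thesis by (simp add: sum_distrib_left)
qed

text \<open>
  Let \<open>k\<close> be the number of vacant neighbours of \<open>x\<close> in \<open>A\<close>. If \<open>k \<ge> 1\<close> then \<open>(1 - k)\<^sup>2 \<le> k * (k - 1)\<close>,
  which is the number of ordered pairs of distinct vacant neighbours in \<open>A\<close>. If \<open>k = 0\<close>, the
  constraint can hold only through a vacant neighbour outside \<open>A\<close>, and the second sum is at least 1.
\<close>

lemma constraint_flip_le:
  fixes A :: "(int ^ 'd::finite) set"
  shows "FA1f_constraint x \<eta> * (1 - vacant_neighbours A x \<eta>)\<^sup>2 \<le>
    (\<Sum>y\<in>A \<inter> neighbours x. \<Sum>z\<in>A \<inter> neighbours x - {y}. vacancy y \<eta> * vacancy z \<eta>)
    + (\<Sum>y\<in>neighbours x - A. vacancy y \<eta>)"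
proof -
  let ?B = "A \<inter> neighbours x" and ?k = "vacant_neighbours A x \<eta>"
  let ?out = "\<Sum>y\<in>neighbours x - A. vacancy y \<eta>"
  have B: "finite ?B" by (simp add: finite_neighbours)
  have "(\<Sum>y\<in>?B. \<Sum>z\<in>?B - {y}. vacancy y \<eta> * vacancy z \<eta>)
      = (\<Sum>y\<in>?B. vacancy y \<eta> * ?k - vacancy y \<eta>)"
  proof (rule sum.cong[OF refl])
    fix y assume y: "y \<in> ?B"
    have "(\<Sum>z\<in>?B - {y}. vacancy z \<eta>) = ?k - vacancy y \<eta>"
      using y B by (simp add: vacant_neighbours_def sum_diff1)
    then show "(\<Sum>z\<in>?B - {y}. vacancy y \<eta> * vacancy z \<eta>) = vacancy y \<eta> * ?k - vacancy y \<eta>"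
      by (simp add: sum_distrib_left[symmetric] right_diff_distrib vacancy_idem)
  qed
  also have "\<dots> = ?k * ?k - ?k"
    by (simp add: sum_subtractf vacant_neighbours_def sum_distrib_right)
  finally have pairs: "(\<Sum>y\<in>?B. \<Sum>z\<in>?B - {y}. vacancy y \<eta> * vacancy z \<eta>) = ?k * ?k - ?k" .
  have out: "0 \<le> ?out" by (intro sum_nonneg vacancy_nonneg)
  have k: "?k = real (card {y \<in> ?B. \<not> \<eta> y})"
    unfolding vacant_neighbours_def vacancy_def
    using B by (simp add: sum.If_cases Int_def)
  have "FA1f_constraint x \<eta> * (1 - ?k)\<^sup>2 \<le> ?k * ?k - ?k + ?out"
  proof (cases "?k = 0")
    case False
    then have k1: "1 \<le> ?k" unfolding k by (simp add: Suc_le_eq)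
    have "FA1f_constraint x \<eta> * (1 - ?k)\<^sup>2 \<le> 1 * (1 - ?k)\<^sup>2"
      by (intro mult_right_mono) (auto simp: FA1f_constraint_def)
    also have "\<dots> \<le> ?k * ?k - ?k"
      using k1 by (simp add: power2_eq_square algebra_simps)
    finally show ?thesis using out by simp
  next
    case True
    have "FA1f_constraint x \<eta> \<le> ?out"
    proof (cases "\<exists>y. l1_norm (y - x) = 1 \<and> \<not> \<eta> y")
      case ex: True
      then obtain y where y: "y \<in> neighbours x" "\<not> \<eta> y" by (auto simp: neighbours_def)
      have "y \<notin> A"
      proof
        assume "y \<in> A"
        then have "y \<in> {y \<in> ?B. \<not> \<eta> y}" using y by simp
        moreover have "{y \<in> ?B. \<not> \<eta> y} = {}"
          using True finite_subset[OF _ B, of "{y \<in> ?B. \<not> \<eta> y}"]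
          unfolding k by (simp only: of_nat_eq_0_iff card_eq_0_iff) blast
        ultimately show False by blast
      qed
      then have "vacancy y \<eta> \<le> ?out"
        using y by (intro member_le_sum) (auto simp: finite_neighbours vacancy_nonneg)
      then show ?thesis using y by (simp add: vacancy_def FA1f_constraint_def)
    qed (use out in \<open>auto simp: FA1f_constraint_def\<close>)
    then show ?thesis using True by simp
  qed
  then show ?thesis using pairs by simp
qed

lemma FA1f_dirichlet_euler_char_le:
  fixes A :: "(int ^ 'd::finite) set" and q :: real
  assumes q: "q \<in> {0<..<1}" and A: "finite A"
  shows "FA1f_dirichlet q (euler_char A) \<le> q * (1 - q) *
    (q\<^sup>2 * (real (card (neighbours (0 :: int ^ 'd))))\<^sup>2 * card A
     + q * (\<Sum>x\<in>A. card (neighbours x - A)))"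
proof -
  let ?K = "card (neighbours (0 :: int ^ 'd))"
  have site: "(\<integral>\<eta>. FA1f_constraint x \<eta> * (1 - vacant_neighbours A x \<eta>)\<^sup>2 \<partial>equilibrium q)
      \<le> q\<^sup>2 * (real ?K)\<^sup>2 + q * card (neighbours x - A)" for x
  proof -
    let ?B = "A \<inter> neighbours x"
    have cB: "card ?B \<le> ?K"
      using card_mono[OF finite_neighbours, of ?B x] card_neighbours[of x] by simp
    have "(\<integral>\<eta>. FA1f_constraint x \<eta> * (1 - vacant_neighbours A x \<eta>)\<^sup>2 \<partial>equilibrium q) \<le>
      (\<integral>\<eta>. (\<Sum>y\<in>?B. \<Sum>z\<in>?B - {y}. vacancy y \<eta> * vacancy z \<eta>)
        + (\<Sum>y\<in>neighbours x - A. vacancy y \<eta>) \<partial>equilibrium q)"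
      by (intro integral_equilibrium_mono local_intros local_function_vacant_neighbours
          constraint_flip_le)
    also have "\<dots> = (\<Sum>y\<in>?B. \<Sum>z\<in>?B - {y}. \<integral>\<eta>. vacancy y \<eta> * vacancy z \<eta> \<partial>equilibrium q)
        + (\<Sum>y\<in>neighbours x - A. \<integral>\<eta>. vacancy y \<eta> \<partial>equilibrium q)"
      by (simp add: integral_simps local_function_integrable local_intros)
    also have "(\<Sum>y\<in>?B. \<Sum>z\<in>?B - {y}. \<integral>\<eta>. vacancy y \<eta> * vacancy z \<eta> \<partial>equilibrium q)
        = (\<Sum>y\<in>?B. \<Sum>z\<in>?B - {y}. q\<^sup>2)"
      by (intro sum.cong refl integral_vacancy_mult[OF q]) auto
    also have "\<dots> \<le> (\<Sum>y\<in>?B. \<Sum>z\<in>?B. q\<^sup>2)"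
      by (intro sum_mono sum_mono2) (auto simp: finite_neighbours)
    also have "\<dots> = q\<^sup>2 * (real (card ?B))\<^sup>2"
      by (simp add: power2_eq_square)
    also have "\<dots> \<le> q\<^sup>2 * (real ?K)\<^sup>2"
      using cB by (simp add: mult_left_mono power_mono)
    finally show ?thesis by (simp add: integral_vacancy[OF q] mult.commute)
  qed
  show ?thesis
    unfolding FA1f_dirichlet_euler_char[OF q A]
  proof (rule mult_left_mono)
    show "0 \<le> q * (1 - q)" using q by simp
    have "(\<Sum>x\<in>A. \<integral>\<eta>. FA1f_constraint x \<eta> * (1 - vacant_neighbours A x \<eta>)\<^sup>2 \<partial>equilibrium q)
      \<le> (\<Sum>x\<in>A. q\<^sup>2 * (real ?K)\<^sup>2 + q * card (neighbours x - A))"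
      by (intro sum_mono site)
    then show "(\<Sum>x\<in>A. \<integral>\<eta>. FA1f_constraint x \<eta> * (1 - vacant_neighbours A x \<eta>)\<^sup>2 \<partial>equilibrium q)
      \<le> q\<^sup>2 * (real ?K)\<^sup>2 * card A + q * (\<Sum>x\<in>A. card (neighbours x - A))"
      by (simp add: sum.distrib sum_distrib_left mult.commute)
  qed
qed

section \<open>The variance\<close>

text \<open>
  The function is compared with the centred number \<open>G\<close> of vacancies in \<open>A\<close>, whose variance is
  \<open>q * (1 - q) * |A|\<close>. By integration by parts, the covariance with \<open>G\<close> is \<open>q * (1 - q)\<close> times the sum
  over \<open>A\<close> of the mean change \<open>1 - q * deg x\<close>, where \<open>deg x\<close> is the number of neighbours of \<open>x\<close> in
  \<open>A\<close>; the assumption on the degrees keeps each term at least \<open>1 / 2\<close>.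
\<close>

lemma equilibrium_variance_euler_char_ge:
  fixes A :: "(int ^ 'd::finite) set" and q :: real
  assumes q: "q \<in> {0<..<1}" and A: "finite A"
    and deg: "\<And>x. x \<in> A \<Longrightarrow> q * card (A \<inter> neighbours x) \<le> 1 / 2"
  shows "q * (1 - q) * card A / 4 \<le> equilibrium_variance q (euler_char A)"
proof -
  define m where "m = (\<integral>\<eta>. euler_char A \<eta> \<partial>equilibrium q)"
  define G where "G = (\<lambda>\<eta>. \<Sum>x\<in>A. vacancy x \<eta> - q)"
  let ?F = "\<lambda>\<eta>. euler_char A \<eta> - m"
  have loc: "local_function ?F" "local_function G"
    unfolding G_def by (intro local_intros local_function_euler_char)+
  have pair: "(\<integral>\<eta>. h \<eta> * G \<eta> \<partial>equilibrium q) = q * (1 - q) *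
      (\<Sum>x\<in>A. \<integral>\<eta>. h (\<eta>(x := False)) - h (\<eta>(x := True)) \<partial>equilibrium q)"
    if "local_function h" for h
  proof -
    have "(\<integral>\<eta>. h \<eta> * G \<eta> \<partial>equilibrium q) = (\<Sum>x\<in>A. \<integral>\<eta>. h \<eta> * (vacancy x \<eta> - q) \<partial>equilibrium q)"
      unfolding G_def sum_distrib_left
      by (intro Bochner_Integration.integral_sum local_function_integrable local_intros that)
    then show ?thesis
      by (simp add: integral_times_centred_vacancy[OF q that] sum_distrib_left)
  qed
  have FG: "q * (1 - q) * (card A / 2) \<le> (\<integral>\<eta>. ?F \<eta> * G \<eta> \<partial>equilibrium q)"
    unfolding pair[OF loc(1)]
  proof (rule mult_left_mono)
    have "1 / 2 \<le> (\<integral>\<eta>. ?F (\<eta>(x := False)) - ?F (\<eta>(x := True)) \<partial>equilibrium q)" if x: "x \<in> A" for x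
    proof -
      have "(\<integral>\<eta>. ?F (\<eta>(x := False)) - ?F (\<eta>(x := True)) \<partial>equilibrium q)
          = (\<integral>\<eta>. 1 - vacant_neighbours A x \<eta> \<partial>equilibrium q)"
        by (simp add: euler_char_flip[OF A x])
      also have "\<dots> = 1 - q * card (A \<inter> neighbours x)"
        by (simp add: vacant_neighbours_def integral_simps local_function_integrable local_intros
            measure_equilibrium_UNIV integral_vacancy[OF q])
      finally show ?thesis using deg[OF x] by simp
    qed
    then have "(\<Sum>x\<in>A. 1 / 2) \<le>
        (\<Sum>x\<in>A. \<integral>\<eta>. ?F (\<eta>(x := False)) - ?F (\<eta>(x := True)) \<partial>equilibrium q)"
      by (rule sum_mono)
    then show "real (card A) / 2 \<le>
        (\<Sum>x\<in>A. \<integral>\<eta>. ?F (\<eta>(x := False)) - ?F (\<eta>(x := True)) \<partial>equilibrium q)"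
      by simp
  qed (use q in simp)
  have G_flip: "G (\<eta>(x := False)) - G (\<eta>(x := True)) = 1" if "x \<in> A" for x \<eta>
  proof -
    have "G (\<eta>(x := False)) - G (\<eta>(x := True)) = (\<Sum>y\<in>A. if y = x then 1 else 0)"
      unfolding G_def sum_subtractf[symmetric] by (intro sum.cong) (auto simp: vacancy_upd)
    then show ?thesis using A that by simp
  qed
  have GG: "(\<integral>\<eta>. G \<eta> * G \<eta> \<partial>equilibrium q) = q * (1 - q) * card A"
    unfolding pair[OF loc(2)] by (simp add: G_flip measure_equilibrium_UNIV)
  \<comment> \<open>By \<open>FG\<close> and \<open>GG\<close> the regression coefficient on \<open>G\<close> is at least \<open>1 / 2\<close>, and subtracting
    \<open>G / 2\<close> gives the best bound that these two facts imply.\<close>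
  have "0 \<le> (\<integral>\<eta>. (?F \<eta> - G \<eta> / 2)\<^sup>2 \<partial>equilibrium q)"
    by simp
  also have "(\<lambda>\<eta>. (?F \<eta> - G \<eta> / 2)\<^sup>2) = (\<lambda>\<eta>. (?F \<eta>)\<^sup>2 - ?F \<eta> * G \<eta> + 1/4 * (G \<eta> * G \<eta>))"
    by (simp add: power2_eq_square field_simps)
  also have "(\<integral>\<eta>. (?F \<eta>)\<^sup>2 - ?F \<eta> * G \<eta> + 1/4 * (G \<eta> * G \<eta>) \<partial>equilibrium q)
      = (\<integral>\<eta>. (?F \<eta>)\<^sup>2 \<partial>equilibrium q) - (\<integral>\<eta>. ?F \<eta> * G \<eta> \<partial>equilibrium q)
        + 1/4 * (\<integral>\<eta>. G \<eta> * G \<eta> \<partial>equilibrium q)"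
    by (subst Bochner_Integration.integral_add Bochner_Integration.integral_diff
        integral_mult_right_zero, (intro local_function_integrable local_intros loc)+)+ simp
  finally show ?thesis
    using FG unfolding GG equilibrium_variance_def m_def by simp
qed

section \<open>From a finite set to the spectral gap\<close>

text \<open>
  The factors \<open>q * (1 - q) * |A|\<close> of the two previous estimates cancel, so that only the ratio \<open>b\<close> of
  boundary to volume depends on \<open>A\<close>. Making \<open>b\<close> of order \<open>q\<close> costs nothing, since \<open>A\<close> may be
  arbitrarily large.
\<close>

lemma FA1f_gap_le_finite_set:
  fixes A :: "(int ^ 'd::finite) set" and q b :: real
  assumes q: "q \<in> {0<..<1}" and A: "finite A" "A \<noteq> {}"
    and deg: "\<And>x. x \<in> A \<Longrightarrow> q * card (A \<inter> neighbours x) \<le> 1 / 2"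
    and bd: "(\<Sum>x\<in>A. card (neighbours x - A)) \<le> b * card A"
  shows "FA1f_gap TYPE('d) q \<le> 4 * (q\<^sup>2 * (real (card (neighbours (0 :: int ^ 'd))))\<^sup>2 + q * b)"
proof -
  let ?D = "FA1f_dirichlet q (euler_char A)" and ?V = "equilibrium_variance q (euler_char A)"
  let ?r = "q\<^sup>2 * (real (card (neighbours (0 :: int ^ 'd))))\<^sup>2 + q * b"
  have V: "q * (1 - q) * card A / 4 \<le> ?V"
    by (rule equilibrium_variance_euler_char_ge[OF q A(1) deg])
  have cA: "0 < real (card A)" using A by (simp add: card_gt_0_iff)
  then have "0 < q * (1 - q) * card A" using q by (intro mult_pos_pos) simp_all
  then have Vpos: "0 < ?V" using V by linarith
  have "?D \<le> q * (1 - q) * (?r * card A)"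
    using FA1f_dirichlet_euler_char_le[OF q A(1)]
  proof (rule order_trans, intro mult_left_mono)
    show "q\<^sup>2 * (real (card (neighbours (0 :: int ^ 'd))))\<^sup>2 * card A
     + q * (\<Sum>x\<in>A. card (neighbours x - A)) \<le> ?r * card A"
      using mult_left_mono[OF bd, of q] q by (simp add: algebra_simps)
  qed (use q in simp)
  also have "\<dots> = 4 * ?r * (q * (1 - q) * card A / 4)" by simp
  finally have D: "?D \<le> 4 * ?r * (q * (1 - q) * card A / 4)" .
  have "0 \<le> b * card A"
    using bd by (rule order_trans[rotated]) (simp del: of_nat_sum)
  then have "0 \<le> b" using cA by (simp add: zero_le_mult_iff)
  then have "0 \<le> 4 * ?r" using q by simp
  then have "?D \<le> 4 * ?r * ?V"
    using D mult_left_mono[OF V] by (meson order_trans)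
  then have ratio: "?D / ?V \<le> 4 * ?r" using Vpos by (simp add: divide_le_eq)
  have "FA1f_gap TYPE('d) q \<le> ?D / ?V"
    unfolding FA1f_gap_def
  proof (rule cInf_lower)
    show "bdd_below {FA1f_dirichlet q f / equilibrium_variance q f | f :: 'd config \<Rightarrow> real.
            local_function f \<and> equilibrium_variance q f \<noteq> 0}"
      using FA1f_dirichlet_nonneg[OF q]
      by (intro bdd_belowI[of _ 0])
        (auto simp: equilibrium_variance_def intro!: divide_nonneg_nonneg)
  qed (use Vpos in \<open>auto intro!: exI[of _ "euler_char A"] local_function_euler_char\<close>)
  then show ?thesis using ratio by simp
qed

section \<open>Boundary and volume of boxes\<close>

definition lattice_box :: "int \<Rightarrow> (int ^ 'd::finite) set" where
  "lattice_box n = {x. \<forall>i. x $ i \<in> {0..<n}}"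

lemma finite_lattice_box: "finite (lattice_box n :: (int ^ 'd::finite) set)"
proof (rule finite_subset)
  show "lattice_box n \<subseteq> vec_lambda ` (PiE UNIV (\<lambda>i::'d. {0..<n}))"
  proof
    fix x :: "int ^ 'd" assume "x \<in> lattice_box n"
    then show "x \<in> vec_lambda ` (PiE UNIV (\<lambda>i::'d. {0..<n}))"
      by (intro image_eqI[where x = "vec_nth x"]) (auto simp: lattice_box_def)
  qed
qed (intro finite_imageI finite_PiE; simp)

text \<open>The \<open>n\<close> translates of a slice in direction \<open>i\<close> are disjoint and fit in the box.\<close>

lemma card_lattice_box_slice:
  fixes i :: "'d::finite"
  assumes n: "0 < n"
  shows "n * int (card {x \<in> lattice_box n. x $ i = c}) \<le> int (card (lattice_box n :: (int ^ 'd) set))"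
proof -
  let ?S = "{x \<in> lattice_box n. x $ i = c} :: (int ^ 'd) set"
  let ?f = "\<lambda>(t, x). \<chi> j. if j = i then t else x $ j"
  have "card ({0..<n} \<times> ?S) \<le> card (lattice_box n :: (int ^ 'd) set)"
  proof (rule card_inj_on_le[OF _ _ finite_lattice_box])
    show "inj_on ?f ({0..<n} \<times> ?S)"
    proof (rule inj_onI, clarify)
      fix t s and x y :: "int ^ 'd"
      assume eq: "(\<chi> j. if j = i then t else x $ j) = (\<chi> j. if j = i then s else y $ j)"
        and xy: "c = x $ i" "y $ i = x $ i"
      from eq have e: "(if j = i then t else x $ j) = (if j = i then s else y $ j)" for j
        by (simp add: vec_eq_iff)
      have "x $ j = y $ j" for j using e[of j] xy by (cases "j = i") auto
      then show "t = s \<and> x = y" using e[of i] by (simp add: vec_eq_iff)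
    qed
    show "?f ` ({0..<n} \<times> ?S) \<subseteq> lattice_box n" by (auto simp: lattice_box_def)
  qed
  then have "int (card ({0..<n} \<times> ?S)) \<le> int (card (lattice_box n :: (int ^ 'd) set))"
    by (rule zle_int[THEN iffD2])
  then show ?thesis using n by (simp add: card_cartesian_product)
qed

text \<open>
  A point with a neighbour outside the box lies on one of the \<open>2 * d\<close> faces, where \<open>d\<close> is the
  dimension, and each face holds at most a fraction \<open>1 / n\<close> of the box.
\<close>

lemma lattice_box_boundary:
  assumes n: "0 < n"
  defines "A \<equiv> lattice_box n :: (int ^ 'd::finite) set"
  shows "n * int (\<Sum>x\<in>A. card (neighbours x - A)) \<le>
    2 * int CARD('d) * int (card (neighbours (0 :: int ^ 'd))) * int (card A)"
proof -
  let ?K = "card (neighbours (0 :: int ^ 'd))"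
  let ?S = "\<lambda>i c. {x \<in> A. x $ i = c}"
  let ?Z = "{x \<in> A. \<not> neighbours x \<subseteq> A}"
  have "?Z \<subseteq> (\<Union>i. ?S i 0 \<union> ?S i (n - 1))"
  proof
    fix x assume "x \<in> ?Z"
    then obtain y where x: "x \<in> A" and y: "y \<in> neighbours x" "y \<notin> A" by auto
    then obtain i where i: "y $ i \<notin> {0..<n}" by (auto simp: A_def lattice_box_def)
    have "\<bar>y $ i - x $ i\<bar> \<le> (\<Sum>i\<in>UNIV. \<bar>y $ i - x $ i\<bar>)"
      by (rule member_le_sum) simp_all
    also have "\<dots> = 1" using y by (simp add: neighbours_def l1_norm_def)
    finally have "\<bar>y $ i - x $ i\<bar> \<le> 1" .
    moreover have "x $ i \<in> {0..<n}" using x by (simp add: A_def lattice_box_def)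
    ultimately have "x $ i = 0 \<or> x $ i = n - 1" using i by auto
    then show "x \<in> (\<Union>i. ?S i 0 \<union> ?S i (n - 1))" using x by auto
  qed
  then have "card ?Z \<le> card (\<Union>i. ?S i 0 \<union> ?S i (n - 1))"
    by (intro card_mono) (auto simp: A_def finite_lattice_box)
  also have "\<dots> \<le> (\<Sum>i\<in>UNIV. card (?S i 0 \<union> ?S i (n - 1)))"
    by (rule card_UN_le) simp
  also have "\<dots> \<le> (\<Sum>i\<in>UNIV. card (?S i 0) + card (?S i (n - 1)))"
    by (intro sum_mono card_Un_le)
  finally have "int (card ?Z) \<le> (\<Sum>i\<in>UNIV. int (card (?S i 0)) + int (card (?S i (n - 1))))"
    by (simp flip: of_nat_sum of_nat_add)
  then have "n * int (card ?Z) \<le>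
      n * (\<Sum>i\<in>UNIV. int (card (?S i 0)) + int (card (?S i (n - 1))))"
    using n by (intro mult_left_mono) auto
  also have "\<dots> = (\<Sum>i\<in>UNIV. n * int (card (?S i 0)) + n * int (card (?S i (n - 1))))"
    by (simp add: sum_distrib_left distrib_left)
  also have "\<dots> \<le> (\<Sum>i::'d\<in>UNIV. int (card A) + int (card A))"
    unfolding A_def by (intro sum_mono add_mono card_lattice_box_slice n)
  finally have Z: "n * int (card ?Z) \<le> 2 * int CARD('d) * int (card A)" by simp
  have "(\<Sum>x\<in>A. card (neighbours x - A)) = (\<Sum>x\<in>?Z. card (neighbours x - A))"
    by (intro sum.mono_neutral_right) (auto simp: A_def finite_lattice_box finite_neighbours)
  also have "\<dots> \<le> (\<Sum>x\<in>?Z. ?K)"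
    by (intro sum_mono) (metis card_neighbours card_mono finite_neighbours Diff_subset)
  finally have "int (\<Sum>x\<in>A. card (neighbours x - A)) \<le> int ?K * int (card ?Z)"
    by (simp add: mult.commute del: of_nat_sum flip: of_nat_mult)
  then have "n * int (\<Sum>x\<in>A. card (neighbours x - A)) \<le> int ?K * (n * int (card ?Z))"
    using n mult_left_mono[of _ _ n] by (subst mult.left_commute) (auto intro: mult_left_mono)
  also have "\<dots> \<le> int ?K * (2 * int CARD('d) * int (card A))"
    by (intro mult_left_mono Z) simp
  finally show ?thesis by (simp add: ac_simps)
qed

section \<open>The upper bound on the gap\<close>

theorem theorem1p1:
  assumes "CARD('d::finite) \<ge> 3"
  shows "\<exists>C>0. \<forall>q\<in>{0<..<1}. FA1f_gap TYPE('d) q \<le> C * q\<^sup>2"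
proof -
  define K where "K = real (card (neighbours (0 :: int ^ 'd)))"
  define d where "d = real CARD('d)"
  let ?C = "12 * K\<^sup>2 + 8 * d * K + 1"
  have nn: "0 \<le> K" "0 \<le> d" by (simp_all add: K_def d_def)
  have "FA1f_gap TYPE('d) q \<le> ?C * q\<^sup>2" if q: "q \<in> {0<..<1}" for q
  proof (cases "q * K \<le> 1 / 2")
    case True
    \<comment> \<open>A side of at least \<open>1 / q\<close> makes the boundary a fraction \<open>O(q)\<close> of the volume.\<close>
    define n where "n = \<lceil>1 / q\<rceil>"
    let ?A = "lattice_box n :: (int ^ 'd) set"
    have n: "0 < n" "1 / q \<le> n" using q by (simp_all add: n_def)
    have "0 \<in> ?A" using n by (simp add: lattice_box_def)
    have bd: "real (\<Sum>x\<in>?A. card (neighbours x - ?A)) \<le> 2 * d * K * q * card ?A"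
    proof -
      let ?s = "real (\<Sum>x\<in>?A. card (neighbours x - ?A))"
      have "real_of_int (n * int (\<Sum>x\<in>?A. card (neighbours x - ?A)))
          \<le> real_of_int (2 * int CARD('d) * int (card (neighbours (0 :: int ^ 'd))) * int (card ?A))"
        using lattice_box_boundary[OF n(1)] by (rule of_int_le_iff[THEN iffD2])
      then have "n * ?s \<le> 2 * d * K * card ?A"
        by (simp add: K_def d_def)
      moreover have "1 / q * ?s \<le> n * ?s"
        using n by (intro mult_right_mono) (simp_all del: of_nat_sum)
      ultimately have "1 / q * ?s \<le> 2 * d * K * card ?A" by linarith
      then show ?thesis using q by (simp add: field_simps)
    qed
    have "FA1f_gap TYPE('d) q \<le> 4 * (q\<^sup>2 * K\<^sup>2 + q * (2 * d * K * q))"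
      unfolding K_def
    proof (rule FA1f_gap_le_finite_set[OF q finite_lattice_box])
      show "?A \<noteq> {}" using \<open>0 \<in> ?A\<close> by auto
      show "q * card (?A \<inter> neighbours x) \<le> 1 / 2" for x
      proof -
        have "real (card (?A \<inter> neighbours x)) \<le> K"
          unfolding K_def
          by (metis card_neighbours card_mono finite_neighbours Int_lower2 of_nat_le_iff)
        then have "q * card (?A \<inter> neighbours x) \<le> q * K"
          using q by (intro mult_left_mono) simp_all
        then show ?thesis using True by simp
      qed
    qed (use bd in \<open>simp add: K_def\<close>)
    also have "\<dots> \<le> ?C * q\<^sup>2"
      using nn q by (simp add: power2_eq_square algebra_simps)
    finally show ?thesis .
  next
    case False
    \<comment> \<open>A single site has degree 0, so the degree condition holds for every \<open>q\<close>; its boundary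
      term \<open>q * K\<close> is harmless because \<open>1 \<le> 2 * q * K\<close>.\<close>
    have "FA1f_gap TYPE('d) q \<le> 4 * (q\<^sup>2 * K\<^sup>2 + q * K)"
      unfolding K_def
    proof (rule FA1f_gap_le_finite_set[OF q, of "{0}"])
      show "q * card ({0} \<inter> neighbours x) \<le> 1 / 2" if "x \<in> {0}" for x
        using that by (simp add: not_in_own_neighbours)
    qed (simp_all add: not_in_own_neighbours)
    also have "q * K \<le> 2 * (q * K) * (q * K)"
      using False mult_right_mono[of 1 "2 * (q * K)" "q * K"] by simp
    also have "4 * (q\<^sup>2 * K\<^sup>2 + 2 * (q * K) * (q * K)) \<le> ?C * q\<^sup>2"
      using nn by (simp add: power2_eq_square algebra_simps)
    finally show ?thesis by simp
  qed
  moreover have "0 < ?C"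
  proof -
    have "0 \<le> 12 * K\<^sup>2 + 8 * d * K" using nn by simp
    then show ?thesis by linarith
  qed
  ultimately show ?thesis by blast
qed

end
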